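(* Let $(V,E,T)$ be an arborescence with thresholds, with leaf set $L$, and consider the Trickle-down sandpile Markov chain on $\Omega$, driven by the source operators $\sigma_\ell$ ($\ell\in L$) with probabilities $y_\ell$ and the topple operators $\theta_v$ ($v\in V$) with probabilities $x_v$. For $v\in V$ let $L_v=\{\ell\in L : v\in \ell^\downarrow\}$, $Y_v=\sum_{\ell\in L_v}y_\ell$, and for $0\le h\le T_v$ let $$\rho_v(h)=\frac{Y_v^{h}\,x_v^{T_v-h}}{\sum_{i=0}^{T_v}Y_v^{i}\,x_v^{T_v-i}}.$$ Then the stationary distribution of the chain is the product measure $$\mathbb{P}(t)=\prod_{v\in V}\rho_v(t_v)\qquad (t=(t_v)_{v\in V}\in\Omega).$$
   Context: An arborescence is a finite directed tree with vertex set $V$, edge set $E$ and a special vertex $r\in V$ (the root) such that there is exactly one directed path from any vertex to $r$. For $v\in V$, $v^\downarrow=(v=v_0\to v_1\to\cdots\to v_a=r)$ denotes this path, and also its set of vertices. $V$ is partially ordered by $v\le w$ iff $v\in w^\downarrow$; the leaves are the maximal vertices (those with no incoming edge), and $L$ is the set of leaves. Each vertex $v$ has a threshold $T_v$, a positive integer, and $T=(T_v)_{v\in V}$. The state space is $\Omega=\{(t_v)_{v\in V} : t_v\in\mathbb{Z},\ 0\le t_v\le T_v\}$. Source operator $\sigma_\ell:\Omega\to\Omega$ for $\ell\in L$: with $\ell^\downarrow=(v_0\to\cdots\to v_a)$, let $k\ge0$ be smallest with $t_{v_k}<T_{v_k}$; then $\sigma_\ell(t)$ is $t$ with $t_{v_k}$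 increased by $1$. If no such $k$ exists, $\sigma_\ell(t)=t$. Topple operator $\theta_v:\Omega\to\Omega$ for $v\in V$: if $t_v=0$, then $\theta_v(t)=t$. If $t_v>0$, write $v^\downarrow=(v=v_0\to\cdots\to v_a=r)$ and let $k\ge1$ be smallest with $t_{v_k}<T_{v_k}$; then $\theta_v(t)$ is $t$ with $t_v$ decreased by $1$ and $t_{v_k}$ increased by $1$; if no such $k$ exists, $\theta_v(t)$ is $t$ with $t_v$ decreased by $1$. Probabilities: real numbers $0<x_v,y_\ell\le1$ ($v\in V$, $\ell\in L$) with $\sum_{v\in V}x_v+\sum_{\ell\in L}y_\ell=1$. The Trickle-down sandpile Markov chain: at each step, from state $t$, move to $\theta_v(t)$ with probability $x_v$ and to $\sigma_\ell(t)$ with probability $y_\ell$ (probabilities leading to the same state are added). *)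

theory Defs
  imports Complex_Main "Graph_Theory.Graph_Theory"
begin

text \<open>
  A directed tree is an orientation of an undirected tree. The library predicate
  \<open>tree\<close> only excludes directed cycles, so it would accept every weakly connected
  acyclic digraph. Here the underlying undirected graph has to be acyclic: the
  symmetric closure \<open>mk_symmetric G\<close> represents it, where a closed walk
  \<open>u, v, u\<close> along an edge and back is a \<open>cycle\<close> of length 2 but not an undirected
  cycle. Antisymmetry excludes a pair of opposite arcs, which \<open>mk_symmetric\<close> merges.
\<close>

definition directed_tree :: "('v, 'e) pre_digraph \<Rightarrow> bool" where
  "directed_tree G \<longleftrightarrow>
     digraph G \<and> connected G \<and> antisym (arcs_ends G) \<and>
     \<not> (\<exists>p. pre_digraph.cycle (with_proj (mk_symmetric G)) p \<and> length p \<ge> 3)"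

definition arborescence :: "('v, 'e) pre_digraph \<Rightarrow> 'v \<Rightarrow> bool" where
  "arborescence G r \<longleftrightarrow>
     directed_tree G \<and> r \<in> verts G \<and> (\<forall>v\<in>verts G. \<exists>!p. pre_digraph.apath G v p r)"

text \<open>The vertices of the path from \<open>v\<close> to the root, in order, starting with \<open>v\<close> itself.\<close>

definition down :: "('v, 'e) pre_digraph \<Rightarrow> 'v \<Rightarrow> 'v \<Rightarrow> 'v list" where
  "down G r v = pre_digraph.awalk_verts G v (THE p. pre_digraph.apath G v p r)"

definition leaves :: "('v, 'e) pre_digraph \<Rightarrow> 'v set" where
  "leaves G = {v \<in> verts G. in_arcs G v = {}}"

text \<open>States are extensional, so that two states are equal iff they agree on all vertices.\<close>

definition states :: "('v, 'e) pre_digraph \<Rightarrow> ('v \<Rightarrow> nat) \<Rightarrow> ('v \<Rightarrow> nat) set" where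
  "states G T = (\<Pi>\<^sub>E v\<in>verts G. {0..T v})"

definition source ::
  "('v, 'e) pre_digraph \<Rightarrow> 'v \<Rightarrow> ('v \<Rightarrow> nat) \<Rightarrow> 'v \<Rightarrow> ('v \<Rightarrow> nat) \<Rightarrow> ('v \<Rightarrow> nat)" where
  "source G r T l t =
     (case find (\<lambda>w. t w < T w) (down G r l) of
        None \<Rightarrow> t
      | Some w \<Rightarrow> t(w := t w + 1))"

definition topple ::
  "('v, 'e) pre_digraph \<Rightarrow> 'v \<Rightarrow> ('v \<Rightarrow> nat) \<Rightarrow> 'v \<Rightarrow> ('v \<Rightarrow> nat) \<Rightarrow> ('v \<Rightarrow> nat)" where
  "topple G r T v t =
     (if t v = 0 then t
      else case find (\<lambda>w. t w < T w) (tl (down G r v)) of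
        None \<Rightarrow> t(v := t v - 1)
      | Some w \<Rightarrow> t(v := t v - 1, w := t w + 1))"

definition trickle_down ::
  "('v, 'e) pre_digraph \<Rightarrow> 'v \<Rightarrow> ('v \<Rightarrow> nat) \<Rightarrow> ('v \<Rightarrow> real) \<Rightarrow> ('v \<Rightarrow> real) \<Rightarrow>
     ('v \<Rightarrow> nat) \<Rightarrow> ('v \<Rightarrow> nat) \<Rightarrow> real" where
  "trickle_down G r T x y t t' =
     (\<Sum>v\<in>{v \<in> verts G. topple G r T v t = t'}. x v) +
     (\<Sum>l\<in>{l \<in> leaves G. source G r T l t = t'}. y l)"

definition stationary_distribution ::
  "'s set \<Rightarrow> ('s \<Rightarrow> 's \<Rightarrow> real) \<Rightarrow> ('s \<Rightarrow> real) \<Rightarrow> bool" where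
  "stationary_distribution S P \<mu> \<longleftrightarrow>
     (\<forall>s\<in>S. \<mu> s \<ge> 0) \<and> (\<Sum>s\<in>S. \<mu> s) = 1 \<and>
     (\<forall>s'\<in>S. (\<Sum>s\<in>S. \<mu> s * P s s') = \<mu> s')"

definition leaves_above :: "('v, 'e) pre_digraph \<Rightarrow> 'v \<Rightarrow> 'v \<Rightarrow> 'v set" where
  "leaves_above G r v = {l \<in> leaves G. v \<in> set (down G r l)}"

definition Y :: "('v, 'e) pre_digraph \<Rightarrow> 'v \<Rightarrow> ('v \<Rightarrow> real) \<Rightarrow> 'v \<Rightarrow> real" where
  "Y G r y v = (\<Sum>l\<in>leaves_above G r v. y l)"

definition \<rho> ::
  "('v, 'e) pre_digraph \<Rightarrow> 'v \<Rightarrow> ('v \<Rightarrow> nat) \<Rightarrow> ('v \<Rightarrow> real) \<Rightarrow> ('v \<Rightarrow> real) \<Rightarrow> 'v \<Rightarrow> nat \<Rightarrow> real" where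
  "\<rho> G r T x y v h =
     (Y G r y v ^ h * x v ^ (T v - h)) / (\<Sum>i=0..T v. Y G r y v ^ i * x v ^ (T v - i))"

end

theory Submission
  imports Defs
begin

text \<open>
  Fix a state \<open>t\<close>, let \<open>W\<close> be the product measure, and let \<open>flow t [v\<^sub>0, \<dots>, v\<^sub>a] * W t\<close> be the mass
  that enters \<open>t\<close> when a grain arrives at \<open>v\<^sub>0\<close> and trickles towards the root (dropping out if the
  whole path is full). Since \<open>W (t + e\<^sub>v) * x\<^sub>v = W t * Y\<^sub>v\<close>, the mass entering \<open>t\<close> through
  \<open>\<theta>\<^sub>v\<close> is \<open>W t * (x\<^sub>v + Y\<^sub>v * (flow t (p v) - flow t (v\<down>)))\<close>, where \<open>p v\<close> is the
  path \<open>v\<down>\<close> without \<open>v\<close>. Writing \<open>Y\<^sub>v\<close> as a sum over leaves, the differences telescope along each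
  \<open>l\<down>\<close> to \<open>y\<^sub>l * (1 - flow t (l\<down>))\<close>, which complements the source contribution
  \<open>y\<^sub>l * flow t (l\<down>)\<close>; the total is \<open>W t * (\<Sum> x + \<Sum> y) = W t\<close>.

  For uniqueness, every toppling of a nonempty vertex brings the grains closer to the root, so the
  zero state is reachable from everywhere.
\<close>

section \<open>Uniqueness of the stationary distribution of a finite chain\<close>

text \<open>
  If \<open>f\<close> is the combination of two stationary vectors that vanishes at \<open>z\<close>, then \<open>\<bar>f\<bar>\<close> is
  subinvariant, hence invariant because its total mass is preserved; its zero set is therefore
  closed under predecessors and contains \<open>z\<close>, so it is everything.
\<close>

lemma stationary_distribution_unique:
  fixes P :: "'s \<Rightarrow> 's \<Rightarrow> real" and m :: "'s \<Rightarrow> nat"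
  assumes "finite S"
    and nonneg: "\<And>s s'. s \<in> S \<Longrightarrow> s' \<in> S \<Longrightarrow> 0 \<le> P s s'"
    and rows: "\<And>s. s \<in> S \<Longrightarrow> (\<Sum>s'\<in>S. P s s') = 1"
    and descent: "\<And>s. s \<in> S \<Longrightarrow> s \<noteq> z \<Longrightarrow> \<exists>s'\<in>S. 0 < P s s' \<and> m s' < m s"
    and z: "z \<in> S" "0 < \<pi> z"
    and \<mu>: "stationary_distribution S P \<mu>" and \<pi>: "stationary_distribution S P \<pi>"
    and "s \<in> S"
  shows "\<mu> s = \<pi> s"
proof -
  define c where "c = \<mu> z / \<pi> z"
  define f where "f s = \<mu> s - c * \<pi> s" for s
  have f_inv: "(\<Sum>s\<in>S. f s * P s s') = f s'" if "s' \<in> S" for s'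
  proof -
    have "(\<Sum>s\<in>S. f s * P s s') = (\<Sum>s\<in>S. \<mu> s * P s s') - c * (\<Sum>s\<in>S. \<pi> s * P s s')"
      by (simp add: f_def algebra_simps sum_subtractf sum_distrib_left)
    with \<mu> \<pi> that show ?thesis
      by (simp add: stationary_distribution_def f_def)
  qed
  have le: "\<bar>f s'\<bar> \<le> (\<Sum>s\<in>S. \<bar>f s\<bar> * P s s')" if "s' \<in> S" for s'
  proof -
    have "\<bar>f s'\<bar> = \<bar>\<Sum>s\<in>S. f s * P s s'\<bar>" using f_inv[OF that] by simp
    also have "\<dots> \<le> (\<Sum>s\<in>S. \<bar>f s * P s s'\<bar>)" by (rule sum_abs)
    also have "\<dots> = (\<Sum>s\<in>S. \<bar>f s\<bar> * P s s')"
      using nonneg that by (intro sum.cong) (auto simp: abs_mult)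
    finally show ?thesis .
  qed
  have "(\<Sum>s'\<in>S. \<Sum>s\<in>S. \<bar>f s\<bar> * P s s') = (\<Sum>s\<in>S. \<bar>f s\<bar> * (\<Sum>s'\<in>S. P s s'))"
    by (subst sum.swap) (simp add: sum_distrib_left)
  also have "\<dots> = (\<Sum>s'\<in>S. \<bar>f s'\<bar>)"
    using rows by simp
  finally have abs_inv: "\<bar>f s'\<bar> = (\<Sum>s\<in>S. \<bar>f s\<bar> * P s s')" if "s' \<in> S" for s'
    using sum_mono_inv[of "\<lambda>s. \<bar>f s\<bar>" S, OF _ le] that \<open>finite S\<close> by metis
  have f0: "f s = 0" if "s \<in> S" for s
    using that
  proof (induction "m s" arbitrary: s rule: less_induct)
    case less
    show ?case
    proof (cases "s = z")
      case True
      then show ?thesis using z by (simp add: f_def c_def)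
    next
      case False
      then obtain s' where s': "s' \<in> S" "0 < P s s'" "m s' < m s"
        using descent less.prems by blast
      have "(\<Sum>s\<in>S. \<bar>f s\<bar> * P s s') = 0"
        using abs_inv[OF s'(1)] less.hyps[OF s'(3,1)] by simp
      then have "\<bar>f s\<bar> * P s s' = 0"
        using less.prems s'(1) nonneg \<open>finite S\<close>
        by (subst (asm) sum_nonneg_eq_0_iff) auto
      with s' show ?thesis by simp
    qed
  qed
  then have eq: "\<mu> s = c * \<pi> s" if "s \<in> S" for s
    using that by (simp add: f_def)
  have "1 = (\<Sum>s\<in>S. \<mu> s)" using \<mu> by (simp add: stationary_distribution_def)
  also have "\<dots> = c * (\<Sum>s\<in>S. \<pi> s)" by (simp add: eq sum_distrib_left)
  finally have "c = 1" using \<pi> by (simp add: stationary_distribution_def)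
  with eq \<open>s \<in> S\<close> show ?thesis by simp
qed

section \<open>Paths to the root in an arborescence\<close>

text \<open>A directed cycle of length at least 3 would be an undirected cycle as well. A cycle of
  length 2 consists of opposite arcs; antisymmetry turns these into loops, which a
  \<open>digraph\<close> lacks.\<close>

lemma directed_tree_imp_forest:
  assumes "directed_tree G"
  shows "forest G"
proof -
  interpret digraph G using assms by (simp add: directed_tree_def)
  interpret S: pair_wf_digraph "mk_symmetric G" ..
  have False if "cycle p" for p
  proof -
    from that obtain u where u: "awalk u p u" "distinct (tl (awalk_verts u p))" "2 \<le> length p"
      by (auto simp: cycle_digraph_conv)
    show False
    proof (cases "length p = 2")
      case True
      then obtain a b where p: "p = [a, b]"
        by (auto simp: numeral_2_eq_2 length_Suc_conv)
      with u have ab: "a \<in> arcs G" "b \<in> arcs G" "tail G a = u" "head G a = tail G b" "head G b = u"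
        by (auto simp: awalk_simps)
      then have "(tail G a, head G a) \<in> arcs_ends G" "(head G a, tail G a) \<in> arcs_ends G"
        by (auto simp: arcs_ends_conv)
      then have "tail G a = head G a"
        using assms by (auto simp: directed_tree_def dest: antisymD)
      then show False using no_loops[OF ab(1)] by simp
    next
      case False
      \<comment> \<open>The arcs of \<open>mk_symmetric G\<close> are pairs of end points, so
        \<open>?e\<close> carries a walk of \<open>G\<close> to a walk through the same
        vertices.\<close>
      let ?e = "\<lambda>e. (tail G e, head G e)"
      have w: "S.awalk v (map ?e q) w \<and> pawalk_verts v (map ?e q) = awalk_verts v q"
        if "awalk v q w" for v q w
        using that
        by (induction q arbitrary: v)
          (auto simp: awalk_simps S.awalk_simps parcs_mk_symmetric)
      have "S.cycle (map ?e p)"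
        unfolding S.cycle_def using w[OF u(1)] u by auto
      moreover have "3 \<le> length (map ?e p)" using u False by simp
      ultimately show False using assms unfolding directed_tree_def by blast
    qed
  qed
  then show ?thesis by (auto simp: forest_def)
qed

locale rooted_arborescence =
  fixes G :: "('v, 'e) pre_digraph" and r :: 'v
  assumes arborescence: "arborescence G r"
begin

sublocale digraph G
  using arborescence by (simp add: arborescence_def directed_tree_def)

abbreviation d where "d \<equiv> down G r"

lemma down_eqI: "apath v p r \<Longrightarrow> d v = awalk_verts v p"
proof -
  assume p: "apath v p r"
  then have "v \<in> verts G" by (auto simp: apath_def)
  then have "\<exists>!p. apath v p r" using arborescence by (auto simp: arborescence_def)
  with p have "(THE p. apath v p r) = p" by blast
  then show ?thesis by (simp add: down_def)
qed

lemma apath_root_exists: "v \<in> verts G \<Longrightarrow> \<exists>p. apath v p r"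
  using arborescence by (auto simp: arborescence_def)

lemma distinct_down: "v \<in> verts G \<Longrightarrow> distinct (d v)"
  using apath_root_exists[of v] by (auto simp: down_eqI apath_def)

lemma set_down_subset:
  assumes "v \<in> verts G"
  shows "set (d v) \<subseteq> verts G"
proof -
  obtain p where p: "apath v p r" using apath_root_exists[OF assms] by blast
  then have "awalk v p r" by (simp add: apath_def)
  then show ?thesis using down_eqI[OF p] awalk_verts_in_verts by (auto simp: awalk_def)
qed

text \<open>Dropping the first arc of a simple path to the root leaves the simple path of its head,
  so \<open>d\<close> unfolds recursively.\<close>

lemma down_cases:
  assumes "v \<in> verts G"
  obtains "d v = [v]" | u where "u \<in> verts G" "d v = v # d u"
proof -
  obtain p where p: "apath v p r" using apath_root_exists assms by blast
  show ?thesis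
  proof (cases p)
    case Nil
    then show ?thesis using down_eqI[OF p] that(1) by simp
  next
    case (Cons e es)
    then have e: "apath (head G e) es r" "tail G e = v" "e \<in> arcs G"
      using p by (auto simp: apath_Cons_iff)
    then have "d v = v # d (head G e)"
      using down_eqI[OF p] down_eqI[OF e(1)] Cons by simp
    then show ?thesis using that(2)[of "head G e"] e by simp
  qed
qed

lemma down_Cons_tl: "v \<in> verts G \<Longrightarrow> d v = v # tl (d v)"
  by (erule down_cases) auto

lemma down_induct [consumes 1, case_names root step]:
  assumes "v \<in> verts G"
    and "\<And>v. v \<in> verts G \<Longrightarrow> d v = [v] \<Longrightarrow> Q v"
    and "\<And>v u. v \<in> verts G \<Longrightarrow> u \<in> verts G \<Longrightarrow> d v = v # d u \<Longrightarrow> Q u \<Longrightarrow> Q v"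
  shows "Q v"
  using assms(1)
proof (induction "length (d v)" arbitrary: v rule: less_induct)
  case less
  from less.prems show ?case
  proof (cases rule: down_cases)
    case 1
    with less.prems assms(2) show ?thesis by blast
  next
    case (2 u)
    with less have "Q u" by simp
    with 2 less.prems assms(3) show ?thesis by blast
  qed
qed

lemma length_down_le: "v \<in> verts G \<Longrightarrow> w \<in> set (d v) \<Longrightarrow> length (d w) \<le> length (d v)"
  by (induction v rule: down_induct) fastforce+

lemma length_down_less:
  "v \<in> verts G \<Longrightarrow> w \<in> set (tl (d v)) \<Longrightarrow> length (d w) < length (d v)"
  by (erule down_cases) (auto simp: less_Suc_eq_le length_down_le)

text \<open>For \<open>w\<close> on the path, \<open>tl (d w)\<close> is \<open>d\<close> of the
  next vertex, or \<open>[]\<close> at the end, so neighbouring terms cancel.\<close>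

lemma sum_down_telescope:
  fixes F :: "'v list \<Rightarrow> real"
  assumes "v \<in> verts G"
  shows "(\<Sum>w\<in>set (d v). F (tl (d w)) - F (d w)) = F [] - F (d v)"
  using assms
proof (induction v rule: down_induct)
  case (root v)
  then show ?case by simp
next
  case (step v u)
  then have "v \<notin> set (d u)" using distinct_down[of v] by simp
  with step show ?case by simp
qed

text \<open>Prepending the arc to the path of its head keeps the path simple: if the tail recurred
  on it, the arc would close a directed cycle. Uniqueness of simple paths then identifies
  it.\<close>

lemma down_tail_arc:
  assumes "e \<in> arcs G"
  shows "d (tail G e) = tail G e # d (head G e)"
proof -
  obtain p where p: "apath (head G e) p r"
    using apath_root_exists[of "head G e"] assms by auto
  have "tail G e \<notin> set (awalk_verts (head G e) p)"
  proof
    assume "tail G e \<in> set (awalk_verts (head G e) p)"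
    then obtain q where "awalk (head G e) q (tail G e)"
      using awalk_decomp p by (metis apath_def)
    then have "closed_w (e # q)"
      using assms by (auto simp: closed_w_def awalk_Cons_iff)
    then show False
      using closed_w_imp_cycle directed_tree_imp_forest[of G] arborescence
      by (auto simp: forest_def arborescence_def)
  qed
  then have "apath (tail G e) (e # p) r"
    using p assms by (simp add: apath_Cons_iff)
  then show ?thesis using down_eqI p by fastforce
qed

text \<open>Among the vertices whose path meets \<open>v\<close>, one with the longest path is a
  leaf: the tail of an incoming arc would have a longer path still meeting \<open>v\<close>. This
  makes \<open>YY v\<close> positive, so that it can be divided by.\<close>

lemma leaves_above_nonempty:
  assumes "v \<in> verts G"
  shows "leaves_above G r v \<noteq> {}"
proof -
  let ?A = "{u \<in> verts G. v \<in> set (d u)}"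
  have "v \<in> ?A" using assms down_Cons_tl[OF assms] by (metis list.set_intros(1) mem_Collect_eq)
  then have "Max ((\<lambda>u. length (d u)) ` ?A) \<in> (\<lambda>u. length (d u)) ` ?A"
    by (intro Max_in) auto
  then obtain u where u: "u \<in> ?A" and len: "length (d u) = Max ((\<lambda>u. length (d u)) ` ?A)"
    by auto
  have max: "length (d w) \<le> length (d u)" if "w \<in> ?A" for w
    unfolding len using that by (intro Max_ge) auto
  have "in_arcs G u = {}"
  proof (rule ccontr)
    assume "in_arcs G u \<noteq> {}"
    then obtain e where "e \<in> arcs G" "head G e = u" by (metis all_not_in_conv in_in_arcs_conv)
    with u max[of "tail G e"] down_tail_arc[of e] show False by auto
  qed
  with u show ?thesis by (auto simp: leaves_above_def leaves_def)
qed

end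

section \<open>Moving one grain along a path\<close>

text \<open>The common core of \<open>source\<close> and \<open>topple\<close>. An arbitrary list in
  place of a path to the root permits induction on the list.\<close>

definition add_grain :: "('v \<Rightarrow> nat) \<Rightarrow> 'v list \<Rightarrow> ('v \<Rightarrow> nat) \<Rightarrow> ('v \<Rightarrow> nat)" where
  "add_grain T vs t =
     (case find (\<lambda>w. t w < T w) vs of None \<Rightarrow> t | Some w \<Rightarrow> t(w := t w + 1))"

lemma add_grain_simps [simp]:
  "add_grain T [] t = t"
  "add_grain T (v # vs) t = (if t v < T v then t(v := t v + 1) else add_grain T vs t)"
  by (simp_all add: add_grain_def)

lemma add_grain_other [simp]: "v \<notin> set vs \<Longrightarrow> add_grain T vs t v = t v"
  by (induction vs) auto

lemma add_grain_cases:
  obtains "add_grain T vs t = t"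
  | w where "w \<in> set vs" "t w < T w" "add_grain T vs t = t(w := t w + 1)"
proof -
  have "add_grain T vs t = t \<or>
      (\<exists>w\<in>set vs. t w < T w \<and> add_grain T vs t = t(w := t w + 1))"
    by (induction vs) auto
  with that show ?thesis by blast
qed

section \<open>The chain, its states and the product weights\<close>

locale trickle_down_chain = rooted_arborescence G r
  for G :: "('v, 'e) pre_digraph" and r :: 'v +
  fixes T :: "'v \<Rightarrow> nat" and x y :: "'v \<Rightarrow> real"
  assumes x_pos: "\<And>v. v \<in> verts G \<Longrightarrow> 0 < x v"
    and y_pos: "\<And>l. l \<in> leaves G \<Longrightarrow> 0 < y l"
    and sum_one: "(\<Sum>v\<in>verts G. x v) + (\<Sum>l\<in>leaves G. y l) = 1"
begin

abbreviation "YY \<equiv> Y G r y"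
abbreviation "\<Omega> \<equiv> states G T"
abbreviation "W t \<equiv> (\<Prod>v\<in>verts G. \<rho> G r T x y v (t v))"

lemma source_eq: "source G r T l t = add_grain T (d l) t"
  by (simp add: source_def add_grain_def)

text \<open>The grain may be removed from \<open>v\<close> before the search for its new place,
  because \<open>v\<close> does not occur on the rest of its own path.\<close>

lemma topple_eq:
  assumes "v \<in> verts G"
  shows "topple G r T v t =
    (if t v = 0 then t else add_grain T (tl (d v)) (t(v := t v - 1)))"
proof -
  have v: "v \<notin> set (tl (d v))"
    using distinct_down[OF assms] down_Cons_tl[OF assms] by (metis distinct.simps(2))
  have "find (\<lambda>w. (t(v := t v - 1)) w < T w) vs = find (\<lambda>w. t w < T w) vs"
    if "v \<notin> set vs" for vs
    using that by (induction vs) auto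
  note f = this[OF v]
  show ?thesis
  proof (cases "find (\<lambda>w. t w < T w) (tl (d v))")
    case None
    with f show ?thesis by (simp add: topple_def add_grain_def)
  next
    case (Some w)
    then have "w \<noteq> v" using v by (metis find_Some_iff nth_mem)
    with Some f show ?thesis by (simp add: topple_def add_grain_def)
  qed
qed

lemma finite_leaves: "finite (leaves G)"
  by (simp add: leaves_def)

lemma leaf_in_verts: "l \<in> leaves G \<Longrightarrow> l \<in> verts G"
  by (simp add: leaves_def)

lemma YY_pos:
  assumes "v \<in> verts G"
  shows "0 < YY v"
  unfolding Y_def
  using leaves_above_nonempty[OF assms] y_pos finite_leaves
  by (intro sum_pos) (auto simp: leaves_above_def)

lemma finite_states: "finite \<Omega>"
  by (simp add: states_def finite_PiE)

lemma states_le: "t \<in> \<Omega> \<Longrightarrow> v \<in> verts G \<Longrightarrow> t v \<le> T v"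
  by (auto simp: states_def dest: PiE_mem)

lemma states_upd: "t \<in> \<Omega> \<Longrightarrow> v \<in> verts G \<Longrightarrow> h \<le> T v \<Longrightarrow> t(v := h) \<in> \<Omega>"
  unfolding states_def by (auto simp: PiE_iff extensional_def)

lemma add_grain_in_states: "t \<in> \<Omega> \<Longrightarrow> set vs \<subseteq> verts G \<Longrightarrow> add_grain T vs t \<in> \<Omega>"
  by (rule add_grain_cases[of T vs t]) (auto intro!: states_upd)

lemma set_tl_down: "v \<in> verts G \<Longrightarrow> set (tl (d v)) \<subseteq> verts G"
  using set_down_subset[of v] by (cases "d v") auto

lemma not_in_tl_down: "v \<in> verts G \<Longrightarrow> v \<notin> set (tl (d v))"
  using length_down_less by blast

lemma topple_in_states: "t \<in> \<Omega> \<Longrightarrow> v \<in> verts G \<Longrightarrow> topple G r T v t \<in> \<Omega>"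
  using states_le[of t v]
  by (auto simp: topple_eq intro!: add_grain_in_states states_upd set_tl_down)

lemma source_in_states: "t \<in> \<Omega> \<Longrightarrow> l \<in> leaves G \<Longrightarrow> source G r T l t \<in> \<Omega>"
  using set_down_subset[of l] leaf_in_verts[of l]
  by (auto simp: source_eq intro!: add_grain_in_states)

lemma \<rho>_pos:
  assumes "v \<in> verts G"
  shows "0 < \<rho> G r T x y v h"
  unfolding \<rho>_def using x_pos[OF assms] YY_pos[OF assms]
  by (intro divide_pos_pos mult_pos_pos sum_pos) auto

lemma W_pos: "0 < W t"
  by (intro prod_pos) (auto intro: \<rho>_pos)

text \<open>Raising \<open>h\<close> by one trades a factor \<open>x v\<close> of the numerator for
  a factor \<open>YY v\<close>; the normalising sum stays the same.\<close>

lemma \<rho>_Suc: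
  assumes "h < T v"
  shows "\<rho> G r T x y v (Suc h) * x v = \<rho> G r T x y v h * YY v"
proof -
  have "T v - h = Suc (T v - Suc h)" using assms by simp
  then show ?thesis by (simp add: \<rho>_def)
qed

lemma W_Suc:
  assumes "v \<in> verts G" "t v < T v"
  shows "W (t(v := Suc (t v))) * x v = W t * YY v"
proof -
  have "(\<Prod>w\<in>verts G - {v}. \<rho> G r T x y w ((t(v := Suc (t v))) w)) =
        (\<Prod>w\<in>verts G - {v}. \<rho> G r T x y w (t w))"
    by (intro prod.cong) auto
  then show ?thesis
    using \<rho>_Suc[OF assms(2)] assms(1)
    by (simp add: prod.remove[of "verts G" v] algebra_simps)
qed

text \<open>The states form a full product of intervals, so the total mass factors into the local
  sums of \<open>\<rho>\<close>, each equal to 1.\<close>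

lemma sum_W: "(\<Sum>t\<in>\<Omega>. W t) = 1"
proof -
  have "(\<Sum>h\<in>{0..T v}. \<rho> G r T x y v h) = 1" if "v \<in> verts G" for v
  proof -
    have "0 < (\<Sum>i=0..T v. YY v ^ i * x v ^ (T v - i))"
      using x_pos[OF that] YY_pos[OF that] by (intro sum_pos) auto
    then show ?thesis by (simp add: \<rho>_def flip: sum_divide_distrib)
  qed
  then have "(\<Prod>v\<in>verts G. \<Sum>h\<in>{0..T v}. \<rho> G r T x y v h) = 1" by simp
  then show ?thesis
    unfolding states_def by (subst (asm) prod_sum_PiE) auto
qed

section \<open>Mass flowing into a state\<close>

text \<open>The first summand stands for a grain that stopped at \<open>v\<close>:
  \<open>x v / YY v\<close> is the weight of the state with one grain fewer at \<open>v\<close>,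
  relative to \<open>t\<close>. The second stands for a grain that found \<open>v\<close> full and
  passed on. The value 1 at \<open>[]\<close> belongs to a grain that has left the system, with
  \<open>t\<close> unchanged.\<close>

primrec flow :: "('v \<Rightarrow> nat) \<Rightarrow> 'v list \<Rightarrow> real" where
  "flow t [] = 1"
| "flow t (v # vs) = (if 0 < t v then x v / YY v else 0) + (if t v = T v then flow t vs else 0)"

lemma sum_W_add_grain:
  assumes "t \<in> \<Omega>" "distinct vs" "set vs \<subseteq> verts G"
  shows "(\<Sum>s | s \<in> \<Omega> \<and> add_grain T vs s = t. W s) = W t * flow t vs"
  using assms(2,3)
proof (induction vs)
  case Nil
  have "{s. s \<in> \<Omega> \<and> s = t} = {t}" using assms(1) by auto
  then show ?case by simp
next
  case (Cons v vs)
  then have v: "v \<in> verts G" "v \<notin> set vs" by auto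
  let ?t = "t(v := t v - 1)"
  \<comment> \<open>The preimages of \<open>t\<close> split by the fate of the grain: in
    \<open>?A\<close> it stopped at \<open>v\<close>, in \<open>?B\<close> it passed a full
    \<open>v\<close>.\<close>
  let ?A = "if 0 < t v then {?t} else {}"
  let ?B = "if t v = T v then {s. s \<in> \<Omega> \<and> add_grain T vs s = t} else {}"
  have tv: "t v \<le> T v" using states_le assms(1) v by blast
  have eq: "{s. s \<in> \<Omega> \<and> add_grain T (v # vs) s = t} = ?A \<union> ?B" (is "?L = ?R")
  proof (intro set_eqI iffI)
    fix s assume s: "s \<in> ?L"
    then have "s v \<le> T v" using states_le v by blast
    then consider "s v < T v" "t = s(v := s v + 1)" | "s v = T v" "add_grain T vs s = t"
      using s by (auto split: if_splits)
    then show "s \<in> ?R"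
      using s v by cases auto
  next
    fix s assume s: "s \<in> ?R"
    have "?t \<in> \<Omega>" using states_upd assms(1) v tv by simp
    with s v tv show "s \<in> ?L"
      by (auto split: if_splits)
  qed
  \<comment> \<open>At \<open>v\<close>, the state in \<open>?A\<close> has one grain fewer than
    \<open>t\<close>, while those in \<open>?B\<close> agree with \<open>t\<close>.\<close>
  have disj: "?A \<inter> ?B = {}"
    using v tv by (auto split: if_splits dest: fun_cong[of _ _ v])
  have "(\<Sum>s\<in>?A. W s) = W t * (if 0 < t v then x v / YY v else 0)"
  proof (cases "0 < t v")
    case True
    then have "W t * x v = W ?t * YY v"
      using W_Suc[of v ?t] v tv by (simp add: fun_upd_idem)
    then show ?thesis using True YY_pos[OF v(1)] by (simp add: field_simps)
  qed simp
  moreover have "(\<Sum>s\<in>?B. W s) = W t * (if t v = T v then flow t vs else 0)"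
    using Cons by simp
  moreover have "finite ?A" "finite ?B" using finite_states by auto
  ultimately show ?case
    unfolding eq by (subst sum.union_disjoint[OF _ _ disj]) (auto simp: algebra_simps)
qed

lemma sum_W_topple:
  assumes t: "t \<in> \<Omega>" and v: "v \<in> verts G"
  shows "x v * (\<Sum>s | s \<in> \<Omega> \<and> topple G r T v s = t. W s) =
    W t * (x v + YY v * (flow t (tl (d v)) - flow t (d v)))"
proof -
  let ?vs = "tl (d v)"
  \<comment> \<open>\<open>?A\<close> covers toppling an empty \<open>v\<close>, and
    \<open>?B\<close> the genuine topplings. \<open>?C\<close> holds the intermediate states, after
    a grain has left \<open>v\<close> and before it lands. They agree with \<open>t\<close> at
    \<open>v\<close>, so they need \<open>t v < T v\<close> to leave room for the removed
    grain.\<close>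
  let ?A = "if t v = 0 then {t} else {}"
  let ?B = "{s. s \<in> \<Omega> \<and> 0 < s v \<and> add_grain T ?vs (s(v := s v - 1)) = t}"
  let ?C = "if t v < T v then {s. s \<in> \<Omega> \<and> add_grain T ?vs s = t} else {}"
  have vs: "v \<notin> set ?vs" "distinct ?vs" "set ?vs \<subseteq> verts G"
    using not_in_tl_down[OF v] distinct_down[OF v] set_tl_down[OF v] by (auto simp: distinct_tl)
  have tv: "t v \<le> T v" using states_le t v by blast
  have eq: "{s. s \<in> \<Omega> \<and> topple G r T v s = t} = ?A \<union> ?B"
    using v t by (auto simp: topple_eq split: if_splits)
  have disj: "?A \<inter> ?B = {}" by auto
  have C: "s v < T v \<and> s v = t v" if "s \<in> ?C" for s
    using that vs by (auto split: if_splits)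
  have "x v * (\<Sum>s\<in>?B. W s) = x v * (\<Sum>s\<in>?C. W (s(v := Suc (s v))))"
  proof (intro arg_cong[of _ _ "(*) (x v)"] sum.reindex_bij_witness
      [of _ "\<lambda>s. s(v := Suc (s v))" "\<lambda>s. s(v := s v - 1)"])
    fix s assume s: "s \<in> ?B"
    show "(s(v := s v - 1))(v := Suc ((s(v := s v - 1)) v)) = s"
      using s by auto
    have "s v \<le> T v" using s states_le v by blast
    moreover have "s v - 1 = t v" using s vs by auto
    ultimately show "s(v := s v - 1) \<in> ?C"
      using s v by (auto intro!: states_upd)
    show "W ((s(v := s v - 1))(v := Suc ((s(v := s v - 1)) v))) = W s"
      using s by (intro prod.cong) auto
  next
    fix s assume s: "s \<in> ?C"
    then show "(s(v := Suc (s v)))(v := (s(v := Suc (s v))) v - 1) = s"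
      by simp
    show "s(v := Suc (s v)) \<in> ?B"
    proof -
      have "s \<in> \<Omega>" "add_grain T ?vs s = t" using s by (auto split: if_splits)
      moreover have "s v < T v" using C[OF s] by simp
      ultimately show ?thesis by (simp add: states_upd[OF _ v])
    qed
  qed
  also have "\<dots> = (\<Sum>s\<in>?C. W (s(v := Suc (s v))) * x v)"
    by (simp add: sum_distrib_left mult.commute)
  also have "\<dots> = (\<Sum>s\<in>?C. W s * YY v)"
    by (rule sum.cong[OF refl], rule W_Suc[OF v]) (use C in blast)
  also have "\<dots> = (\<Sum>s\<in>?C. W s) * YY v"
    by (simp add: sum_distrib_right)
  also have "\<dots> = W t * (if t v < T v then YY v * flow t ?vs else 0)"
    using sum_W_add_grain[OF t vs(2,3)] by simp
  finally have B: "x v * (\<Sum>s\<in>?B. W s) = W t * (if t v < T v then YY v * flow t ?vs else 0)" .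
  have A: "x v * (\<Sum>s\<in>?A. W s) = W t * (if t v = 0 then x v else 0)"
    by simp
  have "flow t (d v) = flow t (v # ?vs)"
    using arg_cong[OF down_Cons_tl[OF v]] .
  then have "YY v * flow t (d v) =
      (if 0 < t v then x v else 0) + (if t v = T v then YY v * flow t ?vs else 0)"
    using YY_pos[OF v] by (simp add: distrib_left)
  \<comment> \<open>The indicators are complementary: \<open>t v = 0\<close> against
    \<open>0 < t v\<close>, and, by \<open>tv\<close>, \<open>t v < T v\<close> against
    \<open>t v = T v\<close>.\<close>
  then have flow_v: "(if t v = 0 then x v else 0) + (if t v < T v then YY v * flow t ?vs else 0) =
      x v + YY v * (flow t ?vs - flow t (d v))"
    using tv unfolding right_diff_distrib by auto
  have "finite ?A" "finite ?B" using finite_states by auto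
  then have "x v * (\<Sum>s | s \<in> \<Omega> \<and> topple G r T v s = t. W s) =
      x v * (\<Sum>s\<in>?A. W s) + x v * (\<Sum>s\<in>?B. W s)"
    unfolding eq by (subst sum.union_disjoint[OF _ _ disj]) (auto simp: algebra_simps)
  also have "\<dots> = W t * ((if t v = 0 then x v else 0) +
      (if t v < T v then YY v * flow t ?vs else 0))"
    unfolding A B by (simp add: algebra_simps)
  also note flow_v
  finally show ?thesis .
qed

lemma sum_flow_difference:
  "(\<Sum>v\<in>verts G. YY v * (flow t (tl (d v)) - flow t (d v))) =
   (\<Sum>l\<in>leaves G. y l * (1 - flow t (d l)))"
proof -
  let ?g = "\<lambda>v. flow t (tl (d v)) - flow t (d v)"
  have "(\<Sum>v\<in>verts G. YY v * ?g v) =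
      (\<Sum>v\<in>verts G. \<Sum>l | l \<in> leaves G \<and> v \<in> set (d l). y l * ?g v)"
    by (simp add: Y_def leaves_above_def sum_distrib_right)
  \<comment> \<open>The pairs of a leaf and a vertex on its path are now grouped by leaf.\<close>
  also have "\<dots> = (\<Sum>l\<in>leaves G. \<Sum>v | v \<in> verts G \<and> v \<in> set (d l). y l * ?g v)"
    using finite_leaves by (intro sum.swap_restrict) auto
  also have "\<dots> = (\<Sum>l\<in>leaves G. y l * (\<Sum>v\<in>set (d l). ?g v))"
  proof (intro sum.cong refl)
    fix l assume "l \<in> leaves G"
    then have "{v. v \<in> verts G \<and> v \<in> set (d l)} = set (d l)"
      using set_down_subset leaf_in_verts by blast
    then show "(\<Sum>v | v \<in> verts G \<and> v \<in> set (d l). y l * ?g v) = y l * (\<Sum>v\<in>set (d l). ?g v)"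
      by (simp add: sum_distrib_left)
  qed
  also have "\<dots> = (\<Sum>l\<in>leaves G. y l * (1 - flow t (d l)))"
    using sum_down_telescope[of _ "flow t"] leaf_in_verts by (intro sum.cong) auto
  finally show ?thesis .
qed

section \<open>Transition probabilities and the balance equation\<close>

abbreviation "P \<equiv> trickle_down G r T x y"

text \<open>With indicators the index sets no longer depend on the states, so these sums can be
  exchanged with sums over \<open>\<Omega>\<close>.\<close>

lemma P_altdef:
  "P s t = (\<Sum>v\<in>verts G. if topple G r T v s = t then x v else 0) +
           (\<Sum>l\<in>leaves G. if source G r T l s = t then y l else 0)"
  using finite_leaves by (simp add: trickle_down_def sum.inter_filter)

lemma balance:
  assumes t: "t \<in> \<Omega>"
  shows "(\<Sum>s\<in>\<Omega>. W s * P s t) = W t"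
proof -
  have "(\<Sum>s\<in>\<Omega>. W s * P s t) =
      (\<Sum>s\<in>\<Omega>. \<Sum>v\<in>verts G. x v * (if topple G r T v s = t then W s else 0)) +
      (\<Sum>s\<in>\<Omega>. \<Sum>l\<in>leaves G. y l * (if source G r T l s = t then W s else 0))"
    unfolding P_altdef
    by (simp add: distrib_left sum.distrib sum_distrib_left if_distrib mult.commute cong: if_cong)
  also have "\<dots> =
      (\<Sum>v\<in>verts G. x v * (\<Sum>s | s \<in> \<Omega> \<and> topple G r T v s = t. W s)) +
      (\<Sum>l\<in>leaves G. y l * (\<Sum>s | s \<in> \<Omega> \<and> source G r T l s = t. W s))"
    using finite_states
    by (subst (1 2) sum.swap) (simp add: sum.inter_filter sum_distrib_left)
  also have "(\<Sum>v\<in>verts G. x v * (\<Sum>s | s \<in> \<Omega> \<and> topple G r T v s = t. W s)) =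
      (\<Sum>v\<in>verts G. W t * (x v + YY v * (flow t (tl (d v)) - flow t (d v))))"
    using sum_W_topple[OF t] by (intro sum.cong) auto
  also have "\<dots> = W t * ((\<Sum>v\<in>verts G. x v) + (\<Sum>l\<in>leaves G. y l * (1 - flow t (d l))))"
    unfolding sum_flow_difference[symmetric] by (simp add: sum.distrib flip: sum_distrib_left)
  also have "(\<Sum>l\<in>leaves G. y l * (\<Sum>s | s \<in> \<Omega> \<and> source G r T l s = t. W s)) =
      (\<Sum>l\<in>leaves G. y l * (W t * flow t (d l)))"
    using sum_W_add_grain[OF t distinct_down set_down_subset] leaf_in_verts
    by (intro sum.cong) (auto simp: source_eq)
  also have "\<dots> = W t * (\<Sum>l\<in>leaves G. y l * flow t (d l))"
    by (simp add: sum_distrib_left algebra_simps)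
  also have "W t * ((\<Sum>v\<in>verts G. x v) + (\<Sum>l\<in>leaves G. y l * (1 - flow t (d l)))) +
      W t * (\<Sum>l\<in>leaves G. y l * flow t (d l)) =
      W t * ((\<Sum>v\<in>verts G. x v) + (\<Sum>l\<in>leaves G. y l))"
    by (simp add: algebra_simps sum_subtractf)
  also have "\<dots> = W t" using sum_one by simp
  finally show ?thesis .
qed

lemma stationary_W: "stationary_distribution \<Omega> P W"
  unfolding stationary_distribution_def
  using W_pos sum_W balance by (auto intro: less_imp_le)

lemma P_nonneg: "0 \<le> P s t"
  unfolding P_altdef
  by (intro add_nonneg_nonneg sum_nonneg) (auto intro: less_imp_le x_pos y_pos)

text \<open>Other moves may lead to the same state, but they only add nonnegative terms to
  \<open>x v\<close>.\<close>

lemma P_topple_pos: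
  assumes "v \<in> verts G"
  shows "0 < P s (topple G r T v s)"
  unfolding P_altdef
proof (rule add_pos_nonneg)
  show "0 < (\<Sum>w\<in>verts G. if topple G r T w s = topple G r T v s then x w else 0)"
    using assms x_pos by (intro sum_pos2[of _ v]) (auto intro: less_imp_le)
  show "0 \<le> (\<Sum>l\<in>leaves G. if source G r T l s = topple G r T v s then y l else 0)"
    by (intro sum_nonneg) (auto intro: less_imp_le y_pos)
qed

text \<open>Each operator maps \<open>\<Omega>\<close> into itself, so it contributes its
  probability to exactly one target state.\<close>

lemma P_row_sum:
  assumes "s \<in> \<Omega>"
  shows "(\<Sum>t\<in>\<Omega>. P s t) = 1"
proof -
  have "(\<Sum>t\<in>\<Omega>. P s t) =
      (\<Sum>v\<in>verts G. \<Sum>t\<in>\<Omega>. if topple G r T v s = t then x v else 0) +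
      (\<Sum>l\<in>leaves G. \<Sum>t\<in>\<Omega>. if source G r T l s = t then y l else 0)"
    unfolding P_altdef sum.distrib by (subst (1 2) sum.swap) simp
  also have "\<dots> = (\<Sum>v\<in>verts G. x v) + (\<Sum>l\<in>leaves G. y l)"
    using finite_states topple_in_states[OF assms] source_in_states[OF assms]
    by (simp add: sum.delta')
  finally show ?thesis using sum_one by simp
qed

section \<open>Descent to the zero state\<close>

text \<open>\<open>length (d v)\<close> counts vertices rather than arcs, so a grain at the root
  still weighs 1 and its departure lowers the potential too.\<close>

definition potential :: "('v \<Rightarrow> nat) \<Rightarrow> nat" where
  "potential t = (\<Sum>v\<in>verts G. t v * length (d v))"

lemma potential_Suc:
  assumes "v \<in> verts G"
  shows "potential (t(v := Suc (t v))) = potential t + length (d v)"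
proof -
  have "(\<Sum>w\<in>verts G - {v}. (t(v := Suc (t v))) w * length (d w)) =
        (\<Sum>w\<in>verts G - {v}. t w * length (d w))"
    by (intro sum.cong) auto
  then show ?thesis
    using assms by (simp add: potential_def sum.remove[of "verts G" v])
qed

lemma potential_topple:
  assumes v: "v \<in> verts G" and "0 < t v"
  shows "potential (topple G r T v t) < potential t"
proof -
  let ?t = "t(v := t v - 1)"
  have pot: "potential t = potential ?t + length (d v)"
    using potential_Suc[OF v, of ?t] assms(2) by (simp add: fun_upd_idem)
  have "topple G r T v t = add_grain T (tl (d v)) ?t"
    using assms by (simp add: topple_eq)
  moreover have "potential (add_grain T (tl (d v)) ?t) < potential ?t + length (d v)"
  \<comment> \<open>Either the grain leaves the system, and its positive weight is lost, or it lands
    at some \<open>w\<close> strictly closer to the root.\<close>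
  proof (cases rule: add_grain_cases[of T "tl (d v)" ?t])
    case 1
    then show ?thesis by (subst down_Cons_tl[OF v]) simp
  next
    case (2 w)
    moreover have "w \<in> verts G" using 2(1) set_tl_down[OF v] by blast
    ultimately show ?thesis
      using potential_Suc[of w ?t] length_down_less[OF v] by simp
  qed
  ultimately show ?thesis using pot by simp
qed

abbreviation "zero_state \<equiv> restrict (\<lambda>_. 0) (verts G) :: 'v \<Rightarrow> nat"

lemma unique_stationary:
  assumes "stationary_distribution \<Omega> P \<nu>" "t \<in> \<Omega>"
  shows "\<nu> t = W t"
proof (rule stationary_distribution_unique[of \<Omega> P zero_state potential])
  show "zero_state \<in> \<Omega>" by (auto simp: states_def)
  fix s assume s: "s \<in> \<Omega>" "s \<noteq> zero_state"
  have "\<exists>v\<in>verts G. 0 < s v"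
  proof (rule ccontr)
    assume "\<not> (\<exists>v\<in>verts G. 0 < s v)"
    \<comment> \<open>Outside \<open>verts G\<close> both states are \<open>undefined\<close>, so
      agreement on the vertices suffices.\<close>
    then have "s = zero_state"
      using s(1) by (intro ext) (auto simp: states_def PiE_iff extensional_def restrict_def)
    with s(2) show False by simp
  qed
  then show "\<exists>s'\<in>\<Omega>. 0 < P s s' \<and> potential s' < potential s"
    using potential_topple P_topple_pos topple_in_states[OF s(1)] by blast
qed (use assms stationary_W W_pos P_nonneg P_row_sum finite_states in auto)

end

theorem theorem2p3:
  fixes G :: "('v, 'e) pre_digraph" and r :: 'v
    and T :: "'v \<Rightarrow> nat" and x y :: "'v \<Rightarrow> real"
  assumes "arborescence G r"
    and "\<And>v. v \<in> verts G \<Longrightarrow> 0 < T v"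
    and "\<And>v. v \<in> verts G \<Longrightarrow> 0 < x v \<and> x v \<le> 1"
    and "\<And>l. l \<in> leaves G \<Longrightarrow> 0 < y l \<and> y l \<le> 1"
    and "(\<Sum>v\<in>verts G. x v) + (\<Sum>l\<in>leaves G. y l) = 1"
  shows "stationary_distribution (states G T) (trickle_down G r T x y)
           (\<lambda>t. \<Prod>v\<in>verts G. \<rho> G r T x y v (t v)) \<and>
         (\<forall>\<mu>. stationary_distribution (states G T) (trickle_down G r T x y) \<mu> \<longrightarrow>
           (\<forall>t\<in>states G T. \<mu> t = (\<Prod>v\<in>verts G. \<rho> G r T x y v (t v))))"
proof -
  interpret trickle_down_chain G r T x y
    using assms by unfold_locales auto
  show ?thesis
    using stationary_W unique_stationary by blast
qed

end
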